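(* The spatially homogeneous solutions to the relativistic Burgers equation on a FLRW background $$ a(t)\,\partial_t v+(1-kr^2)^{1/2}\,\partial_r\Big(\frac{v^2}{2}\Big)+v\Big(1-\frac{v^2}{c^2}\Big)\,a_t(t)=0, $$ namely $$ v(t)=\frac{w}{\sqrt{a(t)^2+\dfrac{w^2}{c^2}}}\in(-c,c), $$ are parametrized by a real parameter $w$ (where $c$ is the light speed).
   Context: The unknown is $v=v(t,r)$, depending on the time variable $t$ and the radial variable $r$. Here $a=a(t)>0$ is a given function (the scale factor of the Friedmann–Lemaître–Robertson–Walker, or FLRW, metric), $a_t$ denotes its derivative in $t$, $k\in\{-1,0,1\}$ is a discrete parameter, and the light speed $c$ is a positive parameter. A solution is spatially homogeneous if $v$ depends only on $t$, so that the term $\partial_r(v^2/2)$ vanishes identically and the equation reduces to $a\,v_t+v\,(1-v^2/c^2)\,a_t=0$.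
   Formalization: The classification is for spatially homogeneous solutions with values in (-c,c); without this restriction it fails, since the constants v = c and v = -c also solve the equation but are not of the displayed form for any real w. *)

theory Defs
  imports "HOL-Analysis.Analysis"
begin

text \<open>
  Classical solutions on a time interval \<open>I\<close> times a radial interval \<open>J\<close>: the two derivatives
  occurring in the equation exist at every point and satisfy it. They are taken within the
  intervals, hence one-sided at an end point, so that for instance \<open>r = 0\<close> may belong to \<open>J\<close>.
  For intervals with nonempty interior they are unique. The function \<open>a_t\<close> is the derivative
  of \<open>a\<close>, which is an assumption wherever the definition is used.
\<close>

definition relativistic_burgers_solution ::
  "real \<Rightarrow> real \<Rightarrow> (real \<Rightarrow> real) \<Rightarrow> (real \<Rightarrow> real) \<Rightarrow> real set \<Rightarrow> real set
    \<Rightarrow> (real \<Rightarrow> real \<Rightarrow> real) \<Rightarrow> bool"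
  where
  "relativistic_burgers_solution c k a a_t I J v \<longleftrightarrow>
    (\<forall>t\<in>I. \<forall>r\<in>J. \<exists>v_t f_r.
      ((\<lambda>s. v s r) has_real_derivative v_t) (at t within I) \<and>
      ((\<lambda>x. (v t x)\<^sup>2 / 2) has_real_derivative f_r) (at r within J) \<and>
      a t * v_t + sqrt (1 - k * r\<^sup>2) * f_r + v t r * (1 - (v t r)\<^sup>2 / c\<^sup>2) * a_t t = 0)"

definition spatially_homogeneous ::
  "real set \<Rightarrow> real set \<Rightarrow> (real \<Rightarrow> real \<Rightarrow> real) \<Rightarrow> bool"
  where
  "spatially_homogeneous I J v \<longleftrightarrow> (\<forall>t\<in>I. \<forall>r\<in>J. \<forall>s\<in>J. v t r = v t s)"

text \<open>
  The equation itself is also solved by \<open>v = c\<close> and \<open>v = - c\<close>, and for bounded \<open>a\<close> by functions with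
  \<open>\<bar>v\<bar> > c\<close>; the velocity of a relativistic fluid lies in the open interval below.
\<close>

definition subluminal ::
  "real \<Rightarrow> real set \<Rightarrow> real set \<Rightarrow> (real \<Rightarrow> real \<Rightarrow> real) \<Rightarrow> bool"
  where
  "subluminal c I J v \<longleftrightarrow> (\<forall>t\<in>I. \<forall>r\<in>J. v t r \<in> {-c<..<c})"

definition homogeneous_profile :: "real \<Rightarrow> (real \<Rightarrow> real) \<Rightarrow> real \<Rightarrow> real \<Rightarrow> real"
  where
  "homogeneous_profile c a w t = w / sqrt ((a t)\<^sup>2 + w\<^sup>2 / c\<^sup>2)"

end

theory Submission imports Defs
begin

text \<open>
  Without the radial term the equation says that the momentum
  \<open>a v / sqrt (1 - v\<^sup>2 / c\<^sup>2)\<close>, per unit rest mass and measured in comoving coordinates, does not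
  change in time. Indeed \<open>v \<mapsto> v / sqrt (1 - v\<^sup>2 / c\<^sup>2)\<close> has derivative
  \<open>(1 - v\<^sup>2 / c\<^sup>2) powr (- 3 / 2)\<close>, so the time derivative of this momentum is
  \<open>a v\<^sub>t + v (1 - v\<^sup>2 / c\<^sup>2) a\<^sub>t\<close> times that factor
  (\<open>comoving_momentum_has_derivative\<close>). The parameter \<open>w\<close> is the constant value of the momentum:
  for fixed \<open>a > 0\<close>, momentum is a bijection from \<open>(-c, c)\<close> onto the reals, whose inverse is
  \<open>w \<mapsto> w / sqrt (a\<^sup>2 + w\<^sup>2 / c\<^sup>2)\<close> (\<open>comoving_momentum_eq_iff\<close>,
  \<open>homogeneous_profile_subluminal\<close>). Thus a homogeneous subluminal
  solution determines \<open>w\<close>, and \<open>w\<close> determines the solution. Conversely, differentiating a profile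
  shows that it satisfies the reduced equation, and it stays below light speed because
  \<open>1 - v\<^sup>2 / c\<^sup>2 = a\<^sup>2 / (a\<^sup>2 + w\<^sup>2 / c\<^sup>2)\<close> is positive.
\<close>

definition comoving_momentum :: "real \<Rightarrow> real \<Rightarrow> real \<Rightarrow> real" where
  "comoving_momentum c a v = a * v / sqrt (1 - v\<^sup>2 / c\<^sup>2)"

lemma lorentz_denominator_pos:
  fixes c v :: real
  assumes "v \<in> {-c<..<c}"
  shows "0 < 1 - v\<^sup>2 / c\<^sup>2"
proof -
  have "v\<^sup>2 < c\<^sup>2"
    using assms by (intro power2_strict_mono) auto
  moreover from this have "0 < c\<^sup>2"
    by (meson le_less_trans zero_le_power2)
  ultimately show ?thesis
    by simp
qed

lemma profile_denominator_pos:
  fixes a c w :: real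
  assumes "a > 0"
  shows "0 < a\<^sup>2 + w\<^sup>2 / c\<^sup>2"
  using assms by (intro add_pos_nonneg) auto

text \<open>
  Positivity of the right-hand side is the bound \<open>\<bar>v\<bar> < c\<close> for a profile; the same formula evaluates
  its momentum and the factor \<open>1 - v\<^sup>2 / c\<^sup>2\<close> in the source term.
\<close>

lemma one_minus_homogeneous_profile:
  assumes "a t > 0"
  shows "1 - (homogeneous_profile c a w t)\<^sup>2 / c\<^sup>2 = (a t)\<^sup>2 / ((a t)\<^sup>2 + w\<^sup>2 / c\<^sup>2)"
proof -
  have pos: "0 < (a t)\<^sup>2 + w\<^sup>2 / c\<^sup>2"
    using assms by (rule profile_denominator_pos)
  have "(homogeneous_profile c a w t)\<^sup>2 / c\<^sup>2 = (w\<^sup>2 / c\<^sup>2) / ((a t)\<^sup>2 + w\<^sup>2 / c\<^sup>2)"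
    using pos by (simp add: homogeneous_profile_def power_divide)
  also have "\<dots> = 1 - (a t)\<^sup>2 / ((a t)\<^sup>2 + w\<^sup>2 / c\<^sup>2)"
  proof -
    have "x / (y + x) = 1 - y / (y + x)" if "0 < y + x" for x y :: real
      using that by (simp add: field_simps)
    then show ?thesis using pos .
  qed
  finally show ?thesis
    by simp
qed

lemma homogeneous_profile_subluminal:
  assumes "c > 0" "a t > 0"
  shows "homogeneous_profile c a w t \<in> {-c<..<c}"
proof -
  have "0 < 1 - (homogeneous_profile c a w t)\<^sup>2 / c\<^sup>2"
    unfolding one_minus_homogeneous_profile[where a = a and t = t, OF \<open>a t > 0\<close>]
    using assms profile_denominator_pos[of "a t" w c] by (intro divide_pos_pos) auto
  then have "(homogeneous_profile c a w t)\<^sup>2 < c\<^sup>2"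
    using \<open>c > 0\<close> by simp
  then have "\<bar>homogeneous_profile c a w t\<bar> < c"
    using \<open>c > 0\<close> by (metis abs_of_pos power2_less_imp_less abs_ge_zero power2_abs less_imp_le)
  then show ?thesis
    by auto
qed

text \<open>
  In one direction \<open>a\<^sup>2 + w\<^sup>2 / c\<^sup>2 = a\<^sup>2 / (1 - v\<^sup>2 / c\<^sup>2)\<close> when \<open>w\<close> is the momentum of \<open>v\<close>; in the
  other, \<open>one_minus_homogeneous_profile\<close> evaluates the square root in the momentum.
\<close>

lemma comoving_momentum_eq_iff:
  assumes "c > 0" "a t > 0" and v: "v \<in> {-c<..<c}"
  shows "comoving_momentum c (a t) v = w \<longleftrightarrow> v = homogeneous_profile c a w t"
proof
  assume w: "comoving_momentum c (a t) v = w"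
  define g where "g = 1 - v\<^sup>2 / c\<^sup>2"
  have g: "g > 0"
    unfolding g_def using v by (rule lorentz_denominator_pos)
  have w': "w = a t * v / sqrt g"
    using w by (simp add: comoving_momentum_def g_def)
  have v2: "v\<^sup>2 / c\<^sup>2 = 1 - g"
    by (simp add: g_def)
  have "w\<^sup>2 / c\<^sup>2 = (a t)\<^sup>2 * (v\<^sup>2 / c\<^sup>2) / g"
    using g by (simp add: w' power_divide power_mult_distrib)
  then have "(a t)\<^sup>2 + w\<^sup>2 / c\<^sup>2 = (a t)\<^sup>2 / g"
    using g by (simp add: v2 field_simps)
  then have "sqrt ((a t)\<^sup>2 + w\<^sup>2 / c\<^sup>2) = a t / sqrt g"
    using \<open>a t > 0\<close> by (simp add: real_sqrt_divide)
  then show "v = homogeneous_profile c a w t"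
    using \<open>a t > 0\<close> g by (simp add: homogeneous_profile_def w')
next
  assume v_eq: "v = homogeneous_profile c a w t"
  have "sqrt (1 - v\<^sup>2 / c\<^sup>2) = a t / sqrt ((a t)\<^sup>2 + w\<^sup>2 / c\<^sup>2)"
    using \<open>a t > 0\<close> unfolding v_eq one_minus_homogeneous_profile[where a = a and t = t, OF \<open>a t > 0\<close>]
    by (simp add: real_sqrt_divide)
  then show "comoving_momentum c (a t) v = w"
    using \<open>a t > 0\<close> profile_denominator_pos[of "a t" w c]
    by (simp add: comoving_momentum_def v_eq homogeneous_profile_def)
qed

text \<open>
  The left-hand side of the reduced equation has the integrating factor
  \<open>(1 - v\<^sup>2 / c\<^sup>2) powr (- 3 / 2)\<close>: multiplied by it, it is an exact derivative.
\<close>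

lemma comoving_momentum_has_derivative:
  fixes a v :: "real \<Rightarrow> real"
  assumes v: "v t \<in> {-c<..<c}"
    and da: "(a has_real_derivative a') (at t within I)"
    and dv: "(v has_real_derivative v') (at t within I)"
  shows "((\<lambda>s. comoving_momentum c (a s) (v s)) has_real_derivative
           (a t * v' + v t * (1 - (v t)\<^sup>2 / c\<^sup>2) * a') / sqrt (1 - (v t)\<^sup>2 / c\<^sup>2) ^ 3)
         (at t within I)"
proof -
  define g where "g = 1 - (v t)\<^sup>2 / c\<^sup>2"
  define q where "q = sqrt g"
  have g: "g > 0"
    unfolding g_def using v by (rule lorentz_denominator_pos)
  then have q: "q > 0" "q\<^sup>2 = g"
    by (simp_all add: q_def)
  have v2: "(v t)\<^sup>2 / c\<^sup>2 = 1 - q\<^sup>2"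
    by (simp add: q g_def)
  have dg: "((\<lambda>s. 1 - (v s)\<^sup>2 / c\<^sup>2) has_real_derivative - (2 * v t * v' / c\<^sup>2)) (at t within I)"
    using DERIV_diff[OF DERIV_const DERIV_cdivide[OF DERIV_power[OF dv, of 2]]]
    by (simp add: mult_ac)
  have dq: "((\<lambda>s. sqrt (1 - (v s)\<^sup>2 / c\<^sup>2)) has_real_derivative - (v t * v' / c\<^sup>2) / q)
      (at t within I)"
    using DERIV_chain2[where f = sqrt, OF DERIV_real_sqrt[OF g[unfolded g_def]] dg] q
    by (simp add: g_def q_def field_simps)
  have q0: "sqrt (1 - (v t)\<^sup>2 / c\<^sup>2) \<noteq> 0"
    using q(1) unfolding q_def g_def by linarith
  have "((\<lambda>s. comoving_momentum c (a s) (v s)) has_real_derivative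
      ((a t * v' + a' * v t) * q - a t * v t * (- (v t * v' / c\<^sup>2) / q)) / (q * q)) (at t within I)"
    unfolding comoving_momentum_def
    using DERIV_divide[OF DERIV_mult[OF da dv] dq q0]
    by (simp add: q_def g_def add.commute mult.commute)
  moreover have "((a t * v' + a' * v t) * q - a t * v t * (- (v t * v' / c\<^sup>2) / q)) / (q * q)
      = (a t * v' + v t * q\<^sup>2 * a') / q ^ 3"
  proof -
    have "a t * v t * (- (v t * v' / c\<^sup>2) / q) = - (a t * v' * ((v t)\<^sup>2 / c\<^sup>2) / q)"
      by (simp add: power2_eq_square)
    then show ?thesis
      unfolding v2 using q(1) by (simp add: field_simps power2_eq_square power3_eq_cube)
  qed
  ultimately show ?thesis
    using q by (simp add: q_def g_def)
qed

lemma homogeneous_profile_has_derivative: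
  assumes "a t > 0" and da: "(a has_real_derivative a') (at t within I)"
  shows "(homogeneous_profile c a w has_real_derivative
           - (w * a t * a') / sqrt ((a t)\<^sup>2 + w\<^sup>2 / c\<^sup>2) ^ 3) (at t within I)"
proof -
  define S where "S = sqrt ((a t)\<^sup>2 + w\<^sup>2 / c\<^sup>2)"
  have pos: "0 < (a t)\<^sup>2 + w\<^sup>2 / c\<^sup>2"
    using \<open>a t > 0\<close> by (rule profile_denominator_pos)
  then have S: "S > 0"
    by (simp add: S_def)
  have da2: "((\<lambda>s. (a s)\<^sup>2 + w\<^sup>2 / c\<^sup>2) has_real_derivative 2 * a t * a') (at t within I)"
    by (auto intro!: derivative_eq_intros da)
  have dS: "((\<lambda>s. sqrt ((a s)\<^sup>2 + w\<^sup>2 / c\<^sup>2)) has_real_derivative a t * a' / S) (at t within I)"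
    using DERIV_chain2[where f = sqrt, OF DERIV_real_sqrt[OF pos] da2] S
    by (simp add: S_def field_simps)
  have "((\<lambda>s. w / sqrt ((a s)\<^sup>2 + w\<^sup>2 / c\<^sup>2)) has_real_derivative
      (0 * S - w * (a t * a' / S)) / (S * S)) (at t within I)"
    using DERIV_divide[OF DERIV_const dS] S by (simp add: S_def)
  then show ?thesis
    using S unfolding homogeneous_profile_def[abs_def] S_def[symmetric]
    by (simp add: power3_eq_cube mult.assoc)
qed

lemma homogeneous_profile_solution:
  assumes "\<And>t. t \<in> I \<Longrightarrow> a t > 0"
    and "\<And>t. t \<in> I \<Longrightarrow> (a has_real_derivative a_t t) (at t within I)"
  shows "relativistic_burgers_solution c k a a_t I J (\<lambda>t r. homogeneous_profile c a w t)"
  unfolding relativistic_burgers_solution_def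
proof (intro ballI)
  fix t r
  assume t: "t \<in> I" and "r \<in> J"
  define S where "S = sqrt ((a t)\<^sup>2 + w\<^sup>2 / c\<^sup>2)"
  have pos: "0 < (a t)\<^sup>2 + w\<^sup>2 / c\<^sup>2"
    using assms(1)[OF t] by (rule profile_denominator_pos)
  then have S: "S > 0" "(a t)\<^sup>2 + w\<^sup>2 / c\<^sup>2 = S\<^sup>2"
    by (simp_all add: S_def)
  have "(homogeneous_profile c a w has_real_derivative - (w * a t * a_t t) / S ^ 3) (at t within I)"
    unfolding S_def using assms t by (intro homogeneous_profile_has_derivative)
  moreover have "((\<lambda>x. (homogeneous_profile c a w t)\<^sup>2 / 2) has_real_derivative 0) (at r within J)"
    by simp
  moreover have "homogeneous_profile c a w t * (1 - (homogeneous_profile c a w t)\<^sup>2 / c\<^sup>2) * a_t t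
      = w / S * ((a t)\<^sup>2 / S\<^sup>2) * a_t t"
    unfolding one_minus_homogeneous_profile[where a = a and t = t, OF assms(1)[OF t]]
    using S(1) by (simp add: homogeneous_profile_def S(2))
  moreover have "a t * (- (w * a t * a_t t) / S ^ 3) + sqrt (1 - k * r\<^sup>2) * 0
      + w / S * ((a t)\<^sup>2 / S\<^sup>2) * a_t t = 0"
    using S(1) by (simp add: power2_eq_square power3_eq_cube)
  ultimately show "\<exists>v_t f_r.
      ((\<lambda>s. homogeneous_profile c a w s) has_real_derivative v_t) (at t within I) \<and>
      ((\<lambda>x. (homogeneous_profile c a w t)\<^sup>2 / 2) has_real_derivative f_r) (at r within J) \<and>
      a t * v_t + sqrt (1 - k * r\<^sup>2) * f_r
        + homogeneous_profile c a w t * (1 - (homogeneous_profile c a w t)\<^sup>2 / c\<^sup>2) * a_t t = 0"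
    by metis
qed

text \<open>
  Nondegeneracy of \<open>J\<close> is what makes the derivative within \<open>J\<close> unique, so that the flux derivative
  in the equation can only be that of a constant.
\<close>

lemma spatially_homogeneous_solution_reduced:
  assumes sol: "relativistic_burgers_solution c k a a_t I J v"
    and hom: "spatially_homogeneous I J v"
    and J: "is_interval J" "interior J \<noteq> {}"
    and t: "t \<in> I" and r: "r \<in> J"
  obtains v_t where "((\<lambda>s. v s r) has_real_derivative v_t) (at t within I)"
    and "a t * v_t + v t r * (1 - (v t r)\<^sup>2 / c\<^sup>2) * a_t t = 0"
proof -
  obtain v_t f_r where dv: "((\<lambda>s. v s r) has_real_derivative v_t) (at t within I)"
    and df: "((\<lambda>x. (v t x)\<^sup>2 / 2) has_real_derivative f_r) (at r within J)"
    and eq: "a t * v_t + sqrt (1 - k * r\<^sup>2) * f_r + v t r * (1 - (v t r)\<^sup>2 / c\<^sup>2) * a_t t = 0"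
    using sol t r unfolding relativistic_burgers_solution_def by blast
  have "J \<noteq> {x}" for x
    using J(2) by auto
  then have "r islimpt J"
    using J(1) r by (intro connected_imp_perfect is_interval_connected)
  then have nontriv: "at r within J \<noteq> bot"
    by (simp add: trivial_limit_within)
  have "((\<lambda>x. (v t x)\<^sup>2 / 2) has_real_derivative 0) (at r within J)"
  proof (rule has_field_derivative_transform_within)
    show "((\<lambda>x. (v t r)\<^sup>2 / 2) has_real_derivative 0) (at r within J)"
      by simp
    show "(v t r)\<^sup>2 / 2 = (v t x)\<^sup>2 / 2" if "x \<in> J" for x
      using hom t r that unfolding spatially_homogeneous_def by metis
  qed (use r in \<open>auto intro: zero_less_one\<close>)
  then have "f_r = 0"
    using df nontriv
    by (metis vector_derivative_unique_within has_real_derivative_iff_has_vector_derivative)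
  with dv eq show thesis
    by (intro that) simp_all
qed

lemma homogeneous_solution_momentum_constant:
  assumes sol: "relativistic_burgers_solution c k a a_t I J v"
    and hom: "spatially_homogeneous I J v"
    and sub: "subluminal c I J v"
    and I: "is_interval I" and J: "is_interval J" "interior J \<noteq> {}" and r: "r \<in> J"
    and da: "\<And>t. t \<in> I \<Longrightarrow> (a has_real_derivative a_t t) (at t within I)"
  shows "\<exists>w. \<forall>t\<in>I. comoving_momentum c (a t) (v t r) = w"
proof (rule has_field_derivative_zero_constant)
  show "convex I"
    using I by (rule is_interval_convex)
  fix t
  assume t: "t \<in> I"
  obtain v_t where dv: "((\<lambda>s. v s r) has_real_derivative v_t) (at t within I)"
    and eq: "a t * v_t + v t r * (1 - (v t r)\<^sup>2 / c\<^sup>2) * a_t t = 0"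
    using spatially_homogeneous_solution_reduced[OF sol hom J t r] .
  have "v t r \<in> {-c<..<c}"
    using sub t r unfolding subluminal_def by blast
  from comoving_momentum_has_derivative[where v = "\<lambda>s. v s r", OF this da[OF t] dv]
  show "((\<lambda>s. comoving_momentum c (a s) (v s r)) has_real_derivative 0) (at t within I)"
    by (simp add: eq)
qed

theorem proposition5p1:
  fixes c k :: real
    and a a_t :: "real \<Rightarrow> real"
    and I J :: "real set"
  assumes "c > 0"
    and "k \<in> {-1, 0, 1}"
    and "is_interval I" and "interior I \<noteq> {}"
    and "is_interval J" and "interior J \<noteq> {}"
    and "\<And>r. r \<in> J \<Longrightarrow> 0 \<le> 1 - k * r\<^sup>2"
    and "\<And>t. t \<in> I \<Longrightarrow> a t > 0"
    and "\<And>t. t \<in> I \<Longrightarrow> (a has_real_derivative a_t t) (at t within I)"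
  shows "(\<forall>w. relativistic_burgers_solution c k a a_t I J (\<lambda>t r. homogeneous_profile c a w t) \<and>
              spatially_homogeneous I J (\<lambda>t r. homogeneous_profile c a w t) \<and>
              subluminal c I J (\<lambda>t r. homogeneous_profile c a w t)) \<and>
         (\<forall>v. relativistic_burgers_solution c k a a_t I J v \<and>
              spatially_homogeneous I J v \<and> subluminal c I J v \<longrightarrow>
              (\<exists>!w. \<forall>t\<in>I. \<forall>r\<in>J. v t r = homogeneous_profile c a w t))"
proof (intro conjI allI impI)
  fix w
  show "relativistic_burgers_solution c k a a_t I J (\<lambda>t r. homogeneous_profile c a w t)"
    using assms(8,9) by (rule homogeneous_profile_solution)
  show "spatially_homogeneous I J (\<lambda>t r. homogeneous_profile c a w t)"
    by (simp add: spatially_homogeneous_def)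
  show "subluminal c I J (\<lambda>t r. homogeneous_profile c a w t)"
    unfolding subluminal_def
    using homogeneous_profile_subluminal[OF \<open>c > 0\<close>] assms(8) by blast
next
  fix v
  assume "relativistic_burgers_solution c k a a_t I J v \<and>
    spatially_homogeneous I J v \<and> subluminal c I J v"
  then have sol: "relativistic_burgers_solution c k a a_t I J v"
    and hom: "spatially_homogeneous I J v" and sub: "subluminal c I J v"
    by blast+
  obtain t0 r0 where t0: "t0 \<in> I" and r0: "r0 \<in> J"
    using assms(4,6) interior_subset by blast
  have momentum_iff: "comoving_momentum c (a t) (v t r) = w \<longleftrightarrow> v t r = homogeneous_profile c a w t"
    if "t \<in> I" "r \<in> J" for t r w
    using that sub assms(8) unfolding subluminal_def
    by (intro comoving_momentum_eq_iff[OF \<open>c > 0\<close>]) auto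
  obtain w where w: "\<And>t. t \<in> I \<Longrightarrow> comoving_momentum c (a t) (v t r0) = w"
    using homogeneous_solution_momentum_constant[OF sol hom sub assms(3,5,6) r0 assms(9)] by blast
  show "\<exists>!w. \<forall>t\<in>I. \<forall>r\<in>J. v t r = homogeneous_profile c a w t"
  proof (rule ex1I)
    show "\<forall>t\<in>I. \<forall>r\<in>J. v t r = homogeneous_profile c a w t"
    proof (intro ballI)
      fix t r
      assume t: "t \<in> I" and r: "r \<in> J"
      have "v t r = v t r0"
        using hom t r r0 unfolding spatially_homogeneous_def by blast
      with w[OF t] show "v t r = homogeneous_profile c a w t"
        by (simp add: momentum_iff[OF t r0])
    qed
  next
    fix w'
    assume "\<forall>t\<in>I. \<forall>r\<in>J. v t r = homogeneous_profile c a w' t"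
    then have "comoving_momentum c (a t0) (v t0 r0) = w'"
      using t0 r0 by (subst momentum_iff) auto
    with w[OF t0] show "w' = w"
      by simp
  qed
qed

end
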